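(* Let $A=(1/2,0)$ and $B=(-1/2,0)$ in the Euclidean plane. For $C$ on the circle with diameter $AB$, $C\neq A,B$, let $\mathcal{Y}$ be the (degenerate) conic through the six vertices of the V-ellipses of $\triangle ABC$. As $C$ ranges over the semicircle with diameter $AB$ lying in $y>0$, the locus of the center of $\mathcal{Y}$ is the arc of the quartic given by $$4(x^2+y^2)^2-8y^3-x^2+2y^2=0,\qquad y>1.$$ As $C$ ranges over the semicircle in $y<0$, the locus of the center is the reflection of this arc about the $x$-axis.
   Context: Given a triangle $\triangle ABC$, the V-ellipse $\mathcal{E}_a$ is the ellipse with foci $B,C$ passing through $A$; $\mathcal{E}_b$ is the ellipse with foci $C,A$ passing through $B$; $\mathcal{E}_c$ is the ellipse with foci $A,B$ passing through $C$. The vertices of an ellipse are its two intersections with its focal axis (the line through the foci). The six vertices of the three V-ellipses always lie on a conic $\mathcal{Y}$ (the Yiu conic), and $\mathcal{Y}$ degenerates to a pair of lines when $\triangle ABC$ is a right triangle; the center of a pair of intersecting lines is their intersection point. *)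

theory Defs
  imports "HOL-Analysis.Analysis"
begin

text \<open>The Euclidean plane is \<^typ>\<open>real \<times> real\<close>, whose metric in HOL-Analysis is the Euclidean one.\<close>

definition v_ellipse :: "real \<times> real \<Rightarrow> real \<times> real \<Rightarrow> real \<times> real \<Rightarrow> (real \<times> real) set" where
  "v_ellipse F G P = {X. dist X F + dist X G = dist P F + dist P G}"

definition v_ellipse_vertices :: "real \<times> real \<Rightarrow> real \<times> real \<Rightarrow> real \<times> real \<Rightarrow> (real \<times> real) set" where
  "v_ellipse_vertices F G P = v_ellipse F G P \<inter> affine hull {F, G}"

definition six_vertices :: "real \<times> real \<Rightarrow> real \<times> real \<Rightarrow> real \<times> real \<Rightarrow> (real \<times> real) set" where
  "six_vertices A B C =
     v_ellipse_vertices B C A \<union> v_ellipse_vertices C A B \<union> v_ellipse_vertices A B C"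

definition conic_section :: "(real \<times> real) set \<Rightarrow> bool" where
  "conic_section S \<longleftrightarrow> (\<exists>a b c d e f :: real. (a, b, c) \<noteq> (0, 0, 0) \<and>
     S = {(x, y). a * x\<^sup>2 + b * x * y + c * y\<^sup>2 + d * x + e * y + f = 0})"

text \<open>A definite description: it is meaningful only when exactly one conic passes through the
  six vertices.\<close>

definition yiu_conic :: "real \<times> real \<Rightarrow> real \<times> real \<Rightarrow> real \<times> real \<Rightarrow> (real \<times> real) set" where
  "yiu_conic A B C = (THE Y. conic_section Y \<and> six_vertices A B C \<subseteq> Y)"

definition is_line :: "(real \<times> real) set \<Rightarrow> bool" where
  "is_line L \<longleftrightarrow> (\<exists>P Q. P \<noteq> Q \<and> L = affine hull {P, Q})"

definition line_pair_meeting_at :: "(real \<times> real) set \<Rightarrow> real \<times> real \<Rightarrow> bool" where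
  "line_pair_meeting_at Y P \<longleftrightarrow>
     (\<exists>L M. is_line L \<and> is_line M \<and> Y = L \<union> M \<and> L \<inter> M = {P})"

text \<open>The center of a degenerate conic consisting of two intersecting lines; unspecified for all
  other sets.\<close>

definition line_pair_center :: "(real \<times> real) set \<Rightarrow> real \<times> real" where
  "line_pair_center Y = (THE P. line_pair_meeting_at Y P)"

end

theory Submission
  imports Defs
begin

text \<open>
  Write a, b for the legs at the right angle C and 1 for the hypotenuse, and let \<sigma> be the sign of
  the ordinate of C. Three of the six vertices lie on one line and three on another. A quadratic
  polynomial vanishing at three distinct points of each of two crossing lines is, in the oblique
  coordinates (s, t) along these lines, a multiple of st; so the Yiu conic is unique and is this pair
  of lines. The lines cross at the point obtained from C by moving by (1 + a + b) / 2 perpendicularly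
  away from AB.

  With u = a + b, the ordinate of C is \<sigma>(u^2 - 1) / 2 and the center (x, y) satisfies
  \<sigma>y = u(u + 1) / 2 and 4x^2 = u^2(2 - u^2). Conversely, after substituting y = u(u + 1) / 2 in the
  quartic, the other root is 4x^2 = 1 - u^2(u + 2)^2, which is negative for u > 1.
\<close>

section \<open>A quadratic polynomial with three roots\<close>

lemma quadratic_three_roots:
  fixes a b c :: real
  assumes "a * r^2 + b * r + c = 0" "a * s^2 + b * s + c = 0" "a * t^2 + b * t + c = 0"
    and "r \<noteq> s" "r \<noteq> t" "s \<noteq> t"
  shows "a = 0" "b = 0" "c = 0"
proof -
  have "(r - s) * (a * (r + s) + b) = 0" "(r - t) * (a * (r + t) + b) = 0"
    using assms(1-3) by algebra+
  then have rs: "a * (r + s) + b = 0" and rt: "a * (r + t) + b = 0"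
    using assms(4-5) by simp_all
  have "a * (s - t) = 0"
    using rs rt by algebra
  then show a: "a = 0"
    using assms(6) by simp
  show b: "b = 0"
    using rs a by simp
  show "c = 0"
    using assms(1) a b by simp
qed

section \<open>Lines, and uniqueness of the decomposition of a line pair\<close>

text \<open>The explicit direction vector makes the parameter \<open>t\<close> usable as an oblique
  coordinate.\<close>

definition line_through :: "real \<times> real \<Rightarrow> real \<times> real \<Rightarrow> (real \<times> real) set" where
  "line_through P d = range (\<lambda>t. P + t *\<^sub>R d)"

lemma line_through_altdef: "line_through P d = affine hull {P, P + d}"
  by (simp add: line_through_def affine_hull_2_alt)

lemma is_line_line_through: "d \<noteq> 0 \<Longrightarrow> is_line (line_through P d)"
  unfolding is_line_def line_through_altdef by (metis add_cancel_left_right)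

lemma is_line_eq_affine_hull:
  assumes "is_line L" "X \<in> L" "Y \<in> L" "X \<noteq> Y"
  shows "L = affine hull {X, Y}"
proof -
  obtain P Q where PQ: "P \<noteq> Q" "L = affine hull {P, Q}"
    using assms(1) by (auto simp: is_line_def)
  have L: "L = range (\<lambda>t. P + t *\<^sub>R (Q - P))"
    by (simp add: PQ(2) affine_hull_2_alt)
  obtain s t where st: "X = P + s *\<^sub>R (Q - P)" "Y = P + t *\<^sub>R (Q - P)"
    using assms(2,3) by (auto simp: L)
  have ne: "t - s \<noteq> 0"
    using assms(4) st by auto
  \<comment> \<open>The affine change of parameter that sends \<open>s\<close> to 0 and
    \<open>t\<close> to 1.\<close>
  have "P + r *\<^sub>R (Q - P) = X + ((r - s) / (t - s)) *\<^sub>R (Y - X)" for r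
  proof -
    have "Y - X = (t - s) *\<^sub>R (Q - P)"
      by (simp add: st algebra_simps)
    then show ?thesis
      using ne unfolding \<open>Y - X = _\<close> by (simp add: st(1) flip: scaleR_left_distrib)
  qed
  then have "L \<subseteq> affine hull {X, Y}"
    unfolding L affine_hull_2_alt by blast
  moreover have "affine hull {X, Y} \<subseteq> L"
    unfolding PQ(2) by (rule hull_minimal) (use assms PQ in auto)
  ultimately show ?thesis
    by blast
qed

text \<open>Of three distinct points of L, two lie on the same line.\<close>

lemma line_subset_Un:
  assumes "is_line L" "is_line L1" "is_line L2" "L \<subseteq> L1 \<union> L2"
  shows "L = L1 \<or> L = L2"
proof -
  obtain P Q where PQ: "P \<noteq> Q" "L = affine hull {P, Q}"
    using assms(1) by (auto simp: is_line_def)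
  \<comment> \<open>The third point is the reflection of \<open>P\<close> in
    \<open>Q\<close>.\<close>
  define R where "R = P + 2 *\<^sub>R (Q - P)"
  have "P \<in> L" "Q \<in> L"
    by (simp_all add: PQ(2) hull_inc)
  moreover have "R \<in> L"
    by (auto simp: PQ(2) affine_hull_2_alt R_def)
  moreover have "R - P = 2 *\<^sub>R (Q - P)" "R - Q = Q - P"
    by (simp_all add: R_def scaleR_2)
  then have "R \<noteq> P" "R \<noteq> Q"
    using PQ(1) by auto
  ultimately obtain X Y where XY: "X \<in> L" "Y \<in> L" "X \<noteq> Y" "X \<in> L1 \<and> Y \<in> L1 \<or> X \<in> L2 \<and> Y \<in> L2"
    using assms(4) PQ(1) that[of P Q] that[of P R] that[of Q R] by fast
  then show ?thesis
    using is_line_eq_affine_hull assms(1-3) by metis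
qed

text \<open>Each line of one decomposition must be a line of the other, so the point set alone
  determines the two lines and their meeting point. Hence \<open>line_pair_center\<close> is well
  defined on line pairs.\<close>

lemma line_pair_meeting_at_iff:
  assumes "is_line L1" "is_line L2" "L1 \<inter> L2 = {P}"
  shows "line_pair_meeting_at (L1 \<union> L2) X \<longleftrightarrow> X = P"
proof
  assume "line_pair_meeting_at (L1 \<union> L2) X"
  then obtain L M where LM: "is_line L" "is_line M" "L1 \<union> L2 = L \<union> M" "L \<inter> M = {X}"
    by (auto simp: line_pair_meeting_at_def)
  have "L1 = L \<or> L1 = M" "L2 = L \<or> L2 = M"
    using LM(1-3) assms(1,2) line_subset_Un[of L1 L M] line_subset_Un[of L2 L M] by blast+
  then have "L1 = L \<and> L2 = M \<or> L1 = M \<and> L2 = L \<or> L1 = L2"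
    by blast
  \<comment> \<open>If the lines coincided, {P} would be a whole line, but a line has two distinct
    points.\<close>
  moreover have "L1 \<noteq> L2"
  proof
    assume "L1 = L2"
    then obtain U V where "U \<noteq> V" "affine hull {U, V} = {P}"
      using assms unfolding is_line_def by (metis Int_absorb)
    then show False
      by (metis hull_inc insertCI singletonD)
  qed
  ultimately have "L1 \<inter> L2 = L \<inter> M"
    by blast
  then show "X = P"
    using assms(3) LM(4) by simp
qed (use assms in \<open>auto simp: line_pair_meeting_at_def\<close>)

section \<open>Conics in oblique coordinates along two crossing lines\<close>

text \<open>Cramer's rule; the nonzero determinant says that the directions (m, n) and (g, h) are
  not parallel.\<close>

lemma line_pair_coordinates:
  fixes p q m n g h :: real
  assumes "m * h - n * g \<noteq> 0"
  obtains s t where "x = p + s * m + t * g" "y = q + s * n + t * h"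
proof
  let ?D = "m * h - n * g"
  show "x = p + ((h * (x - p) - g * (y - q)) / ?D) * m + ((m * (y - q) - n * (x - p)) / ?D) * g"
    "y = q + ((h * (x - p) - g * (y - q)) / ?D) * n + ((m * (y - q) - n * (x - p)) / ?D) * h"
    using assms by (simp_all add: divide_simps; algebra)+
qed

lemma line_pair_Int:
  fixes p q m n g h :: real
  assumes D: "m * h - n * g \<noteq> 0"
  shows "line_through (p, q) (m, n) \<inter> line_through (p, q) (g, h) = {(p, q)}"
proof -
  have "s = 0" if "s * m = t * g" "s * n = t * h" for s t
  proof -
    have "s * (m * h - n * g) = 0"
      using that by algebra
    then show ?thesis
      using D by simp
  qed
  then show ?thesis
    by (fastforce simp: line_through_def image_iff intro: exI[of _ 0])
qed

lemma line_pair_Un_eq: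
  fixes p q m n g h :: real
  assumes D: "m * h - n * g \<noteq> 0"
  shows "(p + s * m + t * g, q + s * n + t * h) \<in> line_through (p, q) (m, n) \<union> line_through (p, q) (g, h)
         \<longleftrightarrow> s * t = 0"
proof
  assume "(p + s * m + t * g, q + s * n + t * h) \<in> line_through (p, q) (m, n) \<union> line_through (p, q) (g, h)"
  then consider r where "s * m + t * g = r * m" "s * n + t * h = r * n"
    | r where "s * m + t * g = r * g" "s * n + t * h = r * h"
    by (fastforce simp: line_through_def add.assoc)
  then show "s * t = 0"
  proof cases
    case 1
    then have "t * (m * h - n * g) = 0" by algebra
    then show ?thesis using D by simp
  next
    case 2
    then have "s * (m * h - n * g) = 0" by algebra
    then show ?thesis using D by simp
  qed
next
  assume "s * t = 0"
  then show "(p + s * m + t * g, q + s * n + t * h) \<in> line_through (p, q) (m, n) \<union> line_through (p, q) (g, h)"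
    by (auto simp: line_through_def)
qed

text \<open>The coefficients come from expanding (h (x - p) - g (y - q)) (m (y - q) - n (x - p)). By
  Cramer's rule this product is s t times the squared determinant.\<close>

lemma conic_section_line_pair:
  fixes p q m n g h :: real
  assumes D: "m * h - n * g \<noteq> 0"
  shows "conic_section (line_through (p, q) (m, n) \<union> line_through (p, q) (g, h))"
proof -
  let ?a = "- h * n" and ?b = "h * m + g * n" and ?c = "- g * m"
  let ?d = "2 * h * n * p - (h * m + g * n) * q" and ?e = "2 * g * m * q - (h * m + g * n) * p"
  let ?f = "(h * m + g * n) * p * q - h * n * p\<^sup>2 - g * m * q\<^sup>2"
  have "(?a, ?b, ?c) \<noteq> (0, 0, 0)"
  proof
    assume "(?a, ?b, ?c) = (0, 0, 0)"
    then have "h * n = 0" "h * m + g * n = 0" "g * m = 0" by auto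
    \<comment> \<open>The squared determinant is the discriminant b^2 - 4 a c of the quadratic
      part.\<close>
    then have "(m * h - n * g) ^ 2 = 0" by algebra
    then show False using D by simp
  qed
  moreover have "(x, y) \<in> line_through (p, q) (m, n) \<union> line_through (p, q) (g, h) \<longleftrightarrow>
      ?a * x\<^sup>2 + ?b * x * y + ?c * y\<^sup>2 + ?d * x + ?e * y + ?f = 0" for x y
  proof -
    obtain s t where st: "x = p + s * m + t * g" "y = q + s * n + t * h"
      using line_pair_coordinates[OF D] by metis
    have "?a * x\<^sup>2 + ?b * x * y + ?c * y\<^sup>2 + ?d * x + ?e * y + ?f = (m * h - n * g)\<^sup>2 * (s * t)"
      unfolding st by algebra
    then show ?thesis
      using line_pair_Un_eq[OF D] D unfolding st by simp
  qed
  ultimately show ?thesis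
    unfolding conic_section_def by blast
qed

text \<open>Restricted to either axis, the polynomial is a quadratic in one variable with three
  roots, so only its s t term can survive. That term is nonzero because the change of coordinates is
  invertible and the quadratic part does not vanish.\<close>

lemma conic_section_six_points:
  fixes p q m n g h :: real
  assumes D: "m * h - n * g \<noteq> 0"
    and Y: "conic_section Y"
    and s: "s1 \<noteq> s2" "s1 \<noteq> s3" "s2 \<noteq> s3" "\<And>s. s \<in> {s1, s2, s3} \<Longrightarrow> (p, q) + s *\<^sub>R (m, n) \<in> Y"
    and t: "t1 \<noteq> t2" "t1 \<noteq> t3" "t2 \<noteq> t3" "\<And>t. t \<in> {t1, t2, t3} \<Longrightarrow> (p, q) + t *\<^sub>R (g, h) \<in> Y"
  shows "Y = line_through (p, q) (m, n) \<union> line_through (p, q) (g, h)"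
proof -
  obtain a b c d e f where abc: "(a, b, c) \<noteq> (0, 0, 0)"
    and Y_eq: "Y = {(x, y). a * x\<^sup>2 + b * x * y + c * y\<^sup>2 + d * x + e * y + f = 0}"
    using Y unfolding conic_section_def by blast
  define Q where "Q x y = a * x\<^sup>2 + b * x * y + c * y\<^sup>2 + d * x + e * y + f" for x y
  \<comment> \<open>The Greek letters are the coefficients of \<open>Q\<close> in the coordinates
    (s, t).\<close>
  define \<alpha> where "\<alpha> = a * m\<^sup>2 + b * m * n + c * n\<^sup>2"
  define \<beta> where "\<beta> = 2 * a * m * g + b * (m * h + n * g) + 2 * c * n * h"
  define \<gamma> where "\<gamma> = a * g\<^sup>2 + b * g * h + c * h\<^sup>2"
  define \<delta> where "\<delta> = 2 * a * p * m + b * (p * n + q * m) + 2 * c * q * n + d * m + e * n"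
  define \<epsilon> where "\<epsilon> = 2 * a * p * g + b * (p * h + q * g) + 2 * c * q * h + d * g + e * h"
  have Q: "Q (p + s * m + t * g) (q + s * n + t * h) =
      \<alpha> * s\<^sup>2 + \<beta> * (s * t) + \<gamma> * t\<^sup>2 + \<delta> * s + \<epsilon> * t + Q p q" for s t
    unfolding Q_def \<alpha>_def \<beta>_def \<gamma>_def \<delta>_def \<epsilon>_def by algebra
  have "\<alpha> * s\<^sup>2 + \<delta> * s + Q p q = 0" if "s \<in> {s1, s2, s3}" for s
    using s(4)[OF that] Q[of s 0] by (simp add: Y_eq Q_def)
  then have s0: "\<alpha> = 0" "\<delta> = 0" "Q p q = 0"
    using quadratic_three_roots[of \<alpha> s1 \<delta> "Q p q" s2 s3] s(1-3) by blast+
  have "\<gamma> * t\<^sup>2 + \<epsilon> * t + Q p q = 0" if "t \<in> {t1, t2, t3}" for t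
    using t(4)[OF that] Q[of 0 t] by (simp add: Y_eq Q_def)
  then have t0: "\<gamma> = 0" "\<epsilon> = 0"
    using quadratic_three_roots[of \<gamma> t1 \<epsilon> "Q p q" t2 t3] t(1-3) by blast+
  have \<beta>: "\<beta> \<noteq> 0"
  proof
    assume "\<beta> = 0"
    \<comment> \<open>The inverse change of coordinates on the quadratic part, multiplied by the
      squared determinant to avoid division.\<close>
    have "(m * h - n * g)\<^sup>2 * a = \<alpha> * h\<^sup>2 - \<beta> * h * n + \<gamma> * n\<^sup>2"
      "(m * h - n * g)\<^sup>2 * b = - 2 * \<alpha> * g * h + \<beta> * (m * h + n * g) - 2 * \<gamma> * m * n"
      "(m * h - n * g)\<^sup>2 * c = \<alpha> * g\<^sup>2 - \<beta> * g * m + \<gamma> * m\<^sup>2"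
      unfolding \<alpha>_def \<beta>_def \<gamma>_def by algebra+
    then show False
      using abc D s0(1) t0(1) \<open>\<beta> = 0\<close> by simp
  qed
  have "(x, y) \<in> Y \<longleftrightarrow> (x, y) \<in> line_through (p, q) (m, n) \<union> line_through (p, q) (g, h)" for x y
  proof -
    obtain s t where st: "x = p + s * m + t * g" "y = q + s * n + t * h"
      using line_pair_coordinates[OF D] by metis
    have "(x, y) \<in> Y \<longleftrightarrow> Q x y = 0"
      by (simp add: Y_eq Q_def)
    also have "\<dots> \<longleftrightarrow> s * t = 0"
      using Q[of s t] s0 t0 \<beta> by (simp add: st)
    finally show ?thesis
      using line_pair_Un_eq[OF D] unfolding st by simp
  qed
  then show ?thesis
    by auto
qed

section \<open>Vertices of the V-ellipses of a right triangle\<close>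

text \<open>On the focal axis, with unit direction \<open>e\<close> and origin \<open>F\<close>, the
  foci lie at 0 and \<open>l\<close>. Between them the sum of distances is constantly
  \<open>l\<close>, so \<open>k > l\<close> leaves just one solution on each outer side.\<close>

lemma v_ellipse_vertices_eq:
  fixes e :: "real \<times> real"
  assumes "norm e = 1" "l > 0" "k > l" "G = F + l *\<^sub>R e" "dist P F + dist P G = k"
  shows "v_ellipse_vertices F G P = {F + ((l + k) / 2) *\<^sub>R e, F + ((l - k) / 2) *\<^sub>R e}"
proof -
  have hull: "affine hull {F, G} = range (\<lambda>t. F + t *\<^sub>R e)"
  proof
    show "affine hull {F, G} \<subseteq> range (\<lambda>t. F + t *\<^sub>R e)"
      by (auto simp: affine_hull_2_alt assms(4))
    have "F + t *\<^sub>R e = F + (t / l) *\<^sub>R (G - F)" for t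
      using assms(2,4) by simp
    then show "range (\<lambda>t. F + t *\<^sub>R e) \<subseteq> affine hull {F, G}"
      unfolding affine_hull_2_alt by blast
  qed
  have dist: "dist (F + t *\<^sub>R e) F + dist (F + t *\<^sub>R e) G = \<bar>t\<bar> + \<bar>t - l\<bar>" for t
  proof -
    have "F + t *\<^sub>R e - G = (t - l) *\<^sub>R e"
      by (simp add: assms(4) algebra_simps)
    then show ?thesis
      by (simp add: dist_norm assms(1))
  qed
  have "\<bar>t\<bar> + \<bar>t - l\<bar> = k \<longleftrightarrow> t = (l + k) / 2 \<or> t = (l - k) / 2" for t
    using assms(2,3) by (auto simp: abs_if)
  then have "{t. \<bar>t\<bar> + \<bar>t - l\<bar> = k} = {(l + k) / 2, (l - k) / 2}"
    by blast
  moreover have "v_ellipse_vertices F G P = (\<lambda>t. F + t *\<^sub>R e) ` {t. \<bar>t\<bar> + \<bar>t - l\<bar> = k}"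
    unfolding v_ellipse_vertices_def v_ellipse_def hull assms(5) by (auto simp flip: dist)
  ultimately show ?thesis
    by simp
qed

text \<open>The hypotenuse AB carries one vertex of each triple; each leg contributes the two vertices on it
  to different triples.\<close>

lemma six_vertices_right_triangle:
  fixes a b \<sigma> :: real
  assumes ab: "a > 0" "b > 0" "a\<^sup>2 + b\<^sup>2 = 1" and \<sigma>: "\<sigma>\<^sup>2 = 1"
  defines "C \<equiv> ((a\<^sup>2 - b\<^sup>2) / 2, \<sigma> * (a * b))"
    and "P \<equiv> ((a\<^sup>2 - b\<^sup>2) / 2, \<sigma> * (a * b + (1 + a + b) / 2))"
    and "d1 \<equiv> ((a - b - 1) / 2, \<sigma> * ((1 + a + b) / 2))"
    and "d2 \<equiv> ((a - b + 1) / 2, \<sigma> * ((1 + a + b) / 2))"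
  shows "six_vertices (1/2, 0) (-1/2, 0) C =
    {P - (1 + a) *\<^sub>R d1, P - a *\<^sub>R d1, P - (a + b) *\<^sub>R d1} \<union>
    {P - (1 + b) *\<^sub>R d2, P - b *\<^sub>R d2, P - (a + b) *\<^sub>R d2}"
proof -
  let ?A = "(1/2, 0) :: real \<times> real" and ?B = "(-1/2, 0) :: real \<times> real"
  have b2: "b\<^sup>2 = 1 - a\<^sup>2"
    using ab(3) by simp
  have x: "(a\<^sup>2 - b\<^sup>2) / 2 = a\<^sup>2 - 1/2" "(a\<^sup>2 - b\<^sup>2) / 2 = 1/2 - b\<^sup>2"
    using ab(3) by (simp_all add: field_simps)
  \<comment> \<open>These are the unit vectors from B to C and from C to A.\<close>
  have e: "norm (a, \<sigma> * b) = 1" "norm (b, - \<sigma> * a) = 1"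
    using ab(3) \<sigma> by (simp_all add: norm_Pair power_mult_distrib add.commute[of "b\<^sup>2"])
  have CB: "C = ?B + a *\<^sub>R (a, \<sigma> * b)"
    unfolding C_def x(1) by (simp add: power2_eq_square)
  have CA: "?A = C + b *\<^sub>R (b, - \<sigma> * a)"
    unfolding C_def x(2) by (simp add: power2_eq_square algebra_simps)
  have "dist C ?B = a"
    unfolding CB dist_norm add_diff_cancel_left' norm_scaleR e(1) using ab(1) by simp
  moreover have "dist ?A C = b"
    unfolding CA dist_norm add_diff_cancel_left' norm_scaleR e(2) using ab(2) by simp
  moreover have "dist ?A ?B = 1"
    by (simp add: dist_Pair_Pair dist_real_def)
  ultimately have dists: "dist C ?B = a" "dist ?B C = a" "dist ?A C = b" "dist C ?A = b"
    "dist ?A ?B = 1" "dist ?B ?A = 1"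
    by (simp_all only: dist_commute)
  \<comment> \<open>The bounds \<open>lt\<close> and \<open>gt\<close> give the strict triangle
    inequalities, which are the condition \<open>k > l\<close> for the three ellipses.\<close>
  have "a\<^sup>2 < 1\<^sup>2" "b\<^sup>2 < 1\<^sup>2"
    using ab by (simp_all add: b2) (metis ab(3) add_less_cancel_left less_add_same_cancel1 zero_less_power)
  then have lt: "a < 1" "b < 1"
    by (auto intro: power2_less_imp_less)
  have "(a + b)\<^sup>2 = 1 + 2 * (a * b)"
    using ab(3) by algebra
  then have "1\<^sup>2 < (a + b)\<^sup>2"
    using ab(1,2) by simp
  then have gt: "1 < a + b"
    using ab(1,2) by (smt (verit) power2_less_imp_less)
  have va: "v_ellipse_vertices ?B C ?A = {?B + ((a + (1 + b)) / 2) *\<^sub>R (a, \<sigma> * b), ?B + ((a - (1 + b)) / 2) *\<^sub>R (a, \<sigma> * b)}"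
    using e(1) ab(1,2) lt CB dists by (intro v_ellipse_vertices_eq) simp_all
  have vb: "v_ellipse_vertices C ?A ?B = {C + ((b + (a + 1)) / 2) *\<^sub>R (b, - \<sigma> * a), C + ((b - (a + 1)) / 2) *\<^sub>R (b, - \<sigma> * a)}"
    using e(2) ab(1,2) lt CA dists by (intro v_ellipse_vertices_eq) simp_all
  have vc: "v_ellipse_vertices ?A ?B C = {?A + ((1 + (a + b)) / 2) *\<^sub>R (-1, 0), ?A + ((1 - (a + b)) / 2) *\<^sub>R (-1, 0)}"
    using gt dists by (intro v_ellipse_vertices_eq) (simp_all add: norm_Pair)
  \<comment> \<open>The directions are scaled so that \<open>d2 - d1\<close> is (1, 0). From P, both
    lines then reach AB at parameter -(a + b), at points a + b apart: the length of the major axis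
    of the ellipse with foci A, B.\<close>
  have pts: "?B + ((a + (1 + b)) / 2) *\<^sub>R (a, \<sigma> * b) = P - a *\<^sub>R d1"
    "?B + ((a - (1 + b)) / 2) *\<^sub>R (a, \<sigma> * b) = P - (1 + b) *\<^sub>R d2"
    "C + ((b + (a + 1)) / 2) *\<^sub>R (b, - \<sigma> * a) = P - (1 + a) *\<^sub>R d1"
    "C + ((b - (a + 1)) / 2) *\<^sub>R (b, - \<sigma> * a) = P - b *\<^sub>R d2"
    "?A + ((1 + (a + b)) / 2) *\<^sub>R (-1, 0) = P - (a + b) *\<^sub>R d2"
    "?A + ((1 - (a + b)) / 2) *\<^sub>R (-1, 0) = P - (a + b) *\<^sub>R d1"
    unfolding C_def P_def d1_def d2_def
    by (simp_all add: power2_eq_square field_simps) (use ab(3) in \<open>(algebra | (rule conjI; algebra))+\<close>)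
  show ?thesis
    unfolding six_vertices_def va vb vc pts by auto
qed

section \<open>The Yiu conic of a right triangle and its center\<close>

lemma yiu_conic_right_triangle:
  fixes x y :: real
  assumes circle: "x\<^sup>2 + y\<^sup>2 = 1/4" and "y \<noteq> 0"
  defines "A \<equiv> (1/2, 0)" and "B \<equiv> (-1/2, 0)"
  shows "\<exists>!Y. conic_section Y \<and> six_vertices A B (x, y) \<subseteq> Y"
    and "line_pair_meeting_at (yiu_conic A B (x, y)) X \<longleftrightarrow>
      X = (x, y + sgn y * ((1 + sqrt (1 + 2 * \<bar>y\<bar>)) / 2))"
proof -
  \<comment> \<open>On the circle, the squared distances from (x, y) to B and A are 1/2 + x and 1/2
    - x.\<close>
  define a where "a = sqrt (1/2 + x)"
  define b where "b = sqrt (1/2 - x)"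
  have "x\<^sup>2 < (1/2)\<^sup>2"
    using assms(1,2) zero_less_power2[of y] by (simp add: power2_eq_square)
  then have "\<bar>x\<bar> < 1/2"
    by (metis power2_abs power2_less_imp_less zero_le_divide_1_iff zero_le_numeral)
  then have ab: "a > 0" "b > 0" "a\<^sup>2 = 1/2 + x" "b\<^sup>2 = 1/2 - x"
    by (auto simp: a_def b_def)
  have "(a * b)\<^sup>2 = \<bar>y\<bar>\<^sup>2"
    using circle ab(3,4) by (simp add: power_mult_distrib) algebra
  \<comment> \<open>Twice the area of the triangle, from the legs and from the hypotenuse 1 with its
    altitude.\<close>
  then have y: "a * b = \<bar>y\<bar>"
    by (rule power2_eq_imp_eq) (use ab(1,2) in simp_all)
  have "(a + b)\<^sup>2 = a\<^sup>2 + b\<^sup>2 + 2 * (a * b)"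
    by algebra
  also have "\<dots> = 1 + 2 * \<bar>y\<bar>"
    unfolding ab(3,4) y by simp
  finally have s: "sqrt (1 + 2 * \<bar>y\<bar>) = a + b"
    using ab(1,2) by (simp add: real_sqrt_unique)
  have sum: "a\<^sup>2 + b\<^sup>2 = 1" and diff: "(a\<^sup>2 - b\<^sup>2) / 2 = x"
    by (simp_all add: ab)
  have \<sigma>: "(sgn y)\<^sup>2 = 1" "sgn y * (a * b) = y"
    using \<open>y \<noteq> 0\<close> by (auto simp: y sgn_if)
  \<comment> \<open>This separates the parameter a + b from 1 + a and from 1 + b, so each line
    carries three distinct vertices.\<close>
  have lt: "a \<noteq> 1" "b \<noteq> 1"
    using ab(1,2) sum by auto
  define p where "p = ((a\<^sup>2 - b\<^sup>2) / 2, sgn y * (a * b + (1 + a + b) / 2))"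
  let ?m = "(a - b - 1) / 2" and ?g = "(a - b + 1) / 2" and ?n = "sgn y * ((1 + a + b) / 2)"
  let ?L1 = "line_through p (?m, ?n)" and ?L2 = "line_through p (?g, ?n)"
  \<comment> \<open>The directions differ by a horizontal unit vector, so the determinant is minus
    their common ordinate.\<close>
  have "?m * ?n - ?n * ?g = (?m - ?g) * ?n"
    by (simp only: right_diff_distrib mult.commute)
  moreover have "?m - ?g = - 1"
    by (simp add: field_simps)
  moreover have n0: "?n \<noteq> 0"
    using ab(1,2) \<open>y \<noteq> 0\<close> by (simp add: sgn_0_0)
  ultimately have D: "?m * ?n - ?n * ?g \<noteq> 0"
    by (simp only: mult_minus1 neg_equal_0_iff_equal not_False_eq_True)
  have p: "p = (x, y + sgn y * ((1 + sqrt (1 + 2 * \<bar>y\<bar>)) / 2))"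
    by (simp only: p_def diff s distrib_left[of _ "a * b"] \<sigma>(2) add.assoc)
  have six: "six_vertices A B (x, y) =
    {p + (- (1 + a)) *\<^sub>R (?m, ?n), p + (- a) *\<^sub>R (?m, ?n), p + (- (a + b)) *\<^sub>R (?m, ?n)} \<union>
    {p + (- (1 + b)) *\<^sub>R (?g, ?n), p + (- b) *\<^sub>R (?g, ?n), p + (- (a + b)) *\<^sub>R (?g, ?n)}"
    using six_vertices_right_triangle[OF ab(1,2) sum \<sigma>(1)]
    unfolding A_def B_def p_def diff \<sigma>(2) scaleR_minus_left add_uminus_conv_diff .
  have conic: "conic_section (?L1 \<union> ?L2)"
    unfolding p by (rule conic_section_line_pair[OF D])
  have sub: "six_vertices A B (x, y) \<subseteq> ?L1 \<union> ?L2"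
    unfolding six line_through_def by blast
  have uniq: "Y = ?L1 \<union> ?L2" if Y: "conic_section Y" "six_vertices A B (x, y) \<subseteq> Y" for Y
    unfolding p
    by (rule conic_section_six_points[OF D Y(1), of "- (1 + a)" "- a" "- (a + b)" _ _ "- (1 + b)" "- b" "- (a + b)"])
      (use Y(2) lt ab(1,2) in \<open>auto simp: six p simp del: scaleR_minus_left scaleR_Pair\<close>)
  show ex: "\<exists>!Y. conic_section Y \<and> six_vertices A B (x, y) \<subseteq> Y"
    using conic sub uniq by blast
  have "yiu_conic A B (x, y) = ?L1 \<union> ?L2"
    unfolding yiu_conic_def
    by (rule the_equality) (intro conjI conic sub, elim conjE, rule uniq)
  moreover have "is_line ?L1" "is_line ?L2"
    by (rule is_line_line_through, use n0 in \<open>unfold zero_prod_def prod.inject, blast\<close>)+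
  moreover have "?L1 \<inter> ?L2 = {p}"
    unfolding p by (rule line_pair_Int[OF D])
  ultimately show "line_pair_meeting_at (yiu_conic A B (x, y)) X \<longleftrightarrow>
      X = (x, y + sgn y * ((1 + sqrt (1 + 2 * \<bar>y\<bar>)) / 2))"
    by (simp only: line_pair_meeting_at_iff flip: p)
qed

section \<open>The quartic arc as an image of the upper semicircle\<close>

lemma quartic_arc_param:
  "(\<lambda>(x, y). (x, y + (1 + sqrt (1 + 2 * y)) / 2)) ` {(x, y). x\<^sup>2 + y\<^sup>2 = 1/4 \<and> y > 0} =
    {(x, y). 4 * (x\<^sup>2 + y\<^sup>2)\<^sup>2 - 8 * y ^ 3 - x\<^sup>2 + 2 * y\<^sup>2 = 0 \<and> y > (1::real)}"
  (is "?f ` ?S = ?T")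
proof
  show "?f ` ?S \<subseteq> ?T"
  proof clarify
    fix x y :: real
    assume xy: "x\<^sup>2 + y\<^sup>2 = 1/4" "y > 0"
    \<comment> \<open>This is the sum of the legs.\<close>
    define u where "u = sqrt (1 + 2 * y)"
    have u: "u\<^sup>2 = 1 + 2 * y" "u > 1"
      using xy(2) by (simp_all add: u_def)
    let ?v = "y + (1 + u) / 2"
    have v: "?v = u * (u + 1) / 2" and y: "y = (u\<^sup>2 - 1) / 2"
      using u(1) by (simp_all add: power2_eq_square field_simps)
    have x2: "x\<^sup>2 = u\<^sup>2 * (2 - u\<^sup>2) / 4"
      using xy(1) unfolding y by (simp add: power2_eq_square field_simps)
    have "4 * (x\<^sup>2 + ?v\<^sup>2)\<^sup>2 - 8 * ?v ^ 3 - x\<^sup>2 + 2 * ?v\<^sup>2 = 0"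
      unfolding x2 v by (simp add: field_simps) algebra
    moreover have "?v > 1"
      using u(2) xy(2) by (simp add: field_simps)
    ultimately show "4 * (x\<^sup>2 + (y + (1 + sqrt (1 + 2 * y)) / 2)\<^sup>2)\<^sup>2 - 8 * (y + (1 + sqrt (1 + 2 * y)) / 2) ^ 3
        - x\<^sup>2 + 2 * (y + (1 + sqrt (1 + 2 * y)) / 2)\<^sup>2 = 0 \<and> y + (1 + sqrt (1 + 2 * y)) / 2 > 1"
      unfolding u_def by blast
  qed
  show "?T \<subseteq> ?f ` ?S"
  proof clarify
    fix x v :: real
    assume eq: "4 * (x\<^sup>2 + v\<^sup>2)\<^sup>2 - 8 * v ^ 3 - x\<^sup>2 + 2 * v\<^sup>2 = 0" and v1: "v > 1"
    \<comment> \<open>Solving v = u (u + 1) / 2 for its positive root: 1 + 8 v = (2 u + 1)^2. The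
      condition v > 1 becomes w > 3, that is u > 1.\<close>
    define w where "w = sqrt (1 + 8 * v)"
    define u where "u = (w - 1) / 2"
    have "w > 3"
      unfolding w_def using v1 by (intro real_less_rsqrt) simp
    then have u1: "u > 1"
      by (simp add: u_def)
    have "w\<^sup>2 = 1 + 8 * v"
      using v1 by (simp add: w_def)
    moreover have "w = 2 * u + 1"
      by (simp add: u_def field_simps)
    ultimately have "(2 * u + 1)\<^sup>2 = 1 + 8 * v"
      by simp
    then have v: "v = u * (u + 1) / 2"
      by (simp add: power2_eq_square algebra_simps)
    \<comment> \<open>Four times the quartic is a monic quadratic in 4 x^2, and it splits over the
      polynomials in u.\<close>
    have "(4 * x\<^sup>2 - u\<^sup>2 * (2 - u\<^sup>2)) * (4 * x\<^sup>2 + u\<^sup>2 * (u + 2)\<^sup>2 - 1) = 0"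
      using eq unfolding v by (simp add: field_simps) algebra
    moreover have "u\<^sup>2 * (u + 2)\<^sup>2 > 1"
      using u1 by (simp add: power_mult_distrib[symmetric] one_less_power less_1_mult)
    then have "4 * x\<^sup>2 + u\<^sup>2 * (u + 2)\<^sup>2 - 1 \<noteq> 0"
      using zero_le_power2[of x] by linarith
    ultimately have x2: "4 * x\<^sup>2 = u\<^sup>2 * (2 - u\<^sup>2)"
      by simp
    define y where "y = (u\<^sup>2 - 1) / 2"
    have "y > 0"
      using u1 by (simp add: y_def one_less_power)
    moreover have "x\<^sup>2 + y\<^sup>2 = 1/4"
      using x2 unfolding y_def by (simp add: field_simps) algebra
    moreover have "1 + 2 * y = u\<^sup>2"
      by (simp add: y_def field_simps)
    then have "sqrt (1 + 2 * y) = u"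
      using u1 by simp
    then have "v = y + (1 + sqrt (1 + 2 * y)) / 2"
      by (simp add: v y_def power2_eq_square field_simps)
    ultimately show "(x, v) \<in> ?f ` ?S"
      by force
  qed
qed

section \<open>The locus of the center over both semicircles\<close>

theorem proposition6:
  fixes A B :: "real \<times> real" and circ quartic_arc :: "(real \<times> real) set"
  assumes "A = (1/2, 0)" and "B = (-1/2, 0)"
    and "circ = sphere (midpoint A B) (dist A B / 2)"
    and "quartic_arc = {(x, y). 4 * (x\<^sup>2 + y\<^sup>2)\<^sup>2 - 8 * y ^ 3 - x\<^sup>2 + 2 * y\<^sup>2 = 0 \<and> y > 1}"
  shows "(\<forall>C \<in> circ - {A, B}.
            (\<exists>!Y. conic_section Y \<and> six_vertices A B C \<subseteq> Y) \<and>
            (\<exists>!P. line_pair_meeting_at (yiu_conic A B C) P)) \<and>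
         (\<lambda>C. line_pair_center (yiu_conic A B C)) ` {C \<in> circ. snd C > 0} = quartic_arc \<and>
         (\<lambda>C. line_pair_center (yiu_conic A B C)) ` {C \<in> circ. snd C < 0}
            = (\<lambda>(x, y). (x, - y)) ` quartic_arc"
proof -
  have "midpoint A B = (0, 0)" "dist A B = 1"
    by (simp_all add: assms(1,2) midpoint_def dist_Pair_Pair dist_real_def)
  then have "(x, y) \<in> circ \<longleftrightarrow> sqrt (x\<^sup>2 + y\<^sup>2) = 1/2" for x y
    by (simp add: assms(3) dist_Pair_Pair dist_real_def)
  also have "1/2 = sqrt (1/4)"
    by (simp add: real_sqrt_divide)
  finally have "(x, y) \<in> circ \<longleftrightarrow> sqrt (x\<^sup>2 + y\<^sup>2) = sqrt (1/4)" for x y .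
  then have circ: "(x, y) \<in> circ \<longleftrightarrow> x\<^sup>2 + y\<^sup>2 = 1/4" for x y
    unfolding real_sqrt_eq_iff .
  let ?c = "\<lambda>C. line_pair_center (yiu_conic A B C)"
  let ?h = "\<lambda>y::real. (1 + sqrt (1 + 2 * \<bar>y\<bar>)) / 2"
  have meet: "line_pair_meeting_at (yiu_conic A B (x, y)) X \<longleftrightarrow> X = (x, y + sgn y * ?h y)"
    if "x\<^sup>2 + y\<^sup>2 = 1/4" "y \<noteq> 0" for x y X
    unfolding assms(1,2) using yiu_conic_right_triangle(2)[OF that] .
  \<comment> \<open>The equivalence \<open>meet\<close> evaluates the definite description of the
    center.\<close>
  have center: "?c (x, y) = (x, y + sgn y * ?h y)" if "x\<^sup>2 + y\<^sup>2 = 1/4" "y \<noteq> 0" for x y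
    unfolding line_pair_center_def meet[OF that] by simp
  \<comment> \<open>The circle meets the line AB only at A and B.\<close>
  have y0: "y \<noteq> 0" if "(x, y) \<in> circ - {A, B}" for x y
  proof
    assume "y = 0"
    then have "x\<^sup>2 = (1/2)\<^sup>2"
      using that circ[of x y] by (simp add: power2_eq_square)
    then show False
      using that \<open>y = 0\<close> by (auto simp: assms(1,2) power2_eq_iff)
  qed
  have "\<forall>C \<in> circ - {A, B}. (\<exists>!Y. conic_section Y \<and> six_vertices A B C \<subseteq> Y) \<and>
      (\<exists>!P. line_pair_meeting_at (yiu_conic A B C) P)"
  proof
    fix C assume C: "C \<in> circ - {A, B}"
    obtain x y where xy: "C = (x, y)" "x\<^sup>2 + y\<^sup>2 = 1/4" "y \<noteq> 0"
      using C y0 circ by (cases C) auto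
    show "(\<exists>!Y. conic_section Y \<and> six_vertices A B C \<subseteq> Y) \<and>
        (\<exists>!P. line_pair_meeting_at (yiu_conic A B C) P)"
      using yiu_conic_right_triangle(1)[OF xy(2,3)] meet[OF xy(2,3)] unfolding xy(1) assms(1,2) by simp
  qed
  moreover have upper: "?c ` {C \<in> circ. snd C > 0} = quartic_arc"
  proof -
    have "{C \<in> circ. snd C > 0} = {(x, y). x\<^sup>2 + y\<^sup>2 = 1/4 \<and> y > 0}"
      using circ by auto
    then have "?c ` {C \<in> circ. snd C > 0} =
        (\<lambda>(x, y). (x, y + (1 + sqrt (1 + 2 * y)) / 2)) ` {(x, y). x\<^sup>2 + y\<^sup>2 = 1/4 \<and> y > 0}"
      by (auto intro!: image_cong simp: center)
    then show ?thesis
      unfolding quartic_arc_param assms(4) .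
  qed
  moreover have "?c ` {C \<in> circ. snd C < 0} = (\<lambda>(x, y). (x, - y)) ` quartic_arc"
  proof -
    let ?r = "\<lambda>(x, y). (x, - y) :: real \<times> real"
    have "{C \<in> circ. snd C < 0} = ?r ` {C \<in> circ. snd C > 0}"
    proof (intro set_eqI iffI)
      fix C assume "C \<in> {C \<in> circ. snd C < 0}"
      then show "C \<in> ?r ` {C \<in> circ. snd C > 0}"
        using circ by (intro image_eqI[of _ _ "?r C"]) (auto split: prod.splits)
    qed (use circ in auto)
    \<comment> \<open>The ordinate y + sgn y * \<open>?h y\<close> is an odd function of y, and the
      abscissa is unchanged, so the center commutes with the reflection.\<close>
    moreover have "?c (?r C) = ?r (?c C)" if "C \<in> {C \<in> circ. snd C > 0}" for C
      using that circ by (cases C) (auto simp: center field_simps)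
    ultimately have "?c ` {C \<in> circ. snd C < 0} = ?r ` ?c ` {C \<in> circ. snd C > 0}"
      by (simp only: image_image cong: image_cong)
    then show ?thesis
      unfolding upper .
  qed
  ultimately show ?thesis
    by (intro conjI)
qed

end
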